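(* Let $\lambda>0$ and let $\mathcal{O}$ be the original dataset, with objective $P_{\mathcal{O}}$ $\lambda$-strongly convex and $\boldsymbol{\theta}_{\mathcal{O}}^*$ its unique minimizer. For each candidate synthetic dataset $\mathcal{S}$ let $\tilde{\boldsymbol{\alpha}}_{\mathcal{S}}\in\mathrm{dom}(D_{\mathcal{S}})$ be a feasible dual variable and let $G_{\mathcal{S}}(\boldsymbol{\theta}_{\mathcal{O}}^*,\tilde{\boldsymbol{\alpha}}_{\mathcal{S}}):=P_{\mathcal{S}}(\boldsymbol{\theta}_{\mathcal{O}}^* )-D_{\mathcal{S}}(\tilde{\boldsymbol{\alpha}}_{\mathcal{S}})$ be the duality gap. For $\boldsymbol{x}\in\mathbb{R}^d$ put $$Q_{\boldsymbol{x}}(\mathcal{S}):=\max_{\boldsymbol{\theta}:\ \|\boldsymbol{\theta}-\boldsymbol{\theta}_{\mathcal{O}}^*\|_2\le\sqrt{\frac{2}{\lambda}G_{\mathcal{S}}(\boldsymbol{\theta}_{\mathcal{O}}^*,\tilde{\boldsymbol{\alpha}}_{\mathcal{S}})}}\ \bigl|\boldsymbol{\phi}(\boldsymbol{x})^\top\boldsymbol{\theta}-\boldsymbol{\phi}(\boldsymbol{x})^\top\boldsymbol{\theta}_{\mathcal{O}}^*\bigr| .$$ Then minimizing the duality gap with respect to $\mathcal{S}$ also minimizes $Q_{\boldsymbol{x}}(\mathcal{S})$ for every $\boldsymbol{x}$: if $\mathcal{S}_0$ minimizes $\mathcal{S}\mapsto G_{\mathcal{S}}(\boldsymbol{\theta}_{\mathcal{O}}^*,\tilde{\boldsymbol{\alpha}}_{\mathcal{S}})$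 over the set of candidates, then for every $\boldsymbol{x}\in\mathbb{R}^d$, $\mathcal{S}_0$ minimizes $\mathcal{S}\mapsto Q_{\boldsymbol{x}}(\mathcal{S})$ over the same set. Equivalently, shrinking the duality gap reduces the worst-case difference in predicted values: if $G_{\mathcal{S}_1}(\boldsymbol{\theta}_{\mathcal{O}}^*,\tilde{\boldsymbol{\alpha}}_{\mathcal{S}_1})\le G_{\mathcal{S}_2}(\boldsymbol{\theta}_{\mathcal{O}}^*,\tilde{\boldsymbol{\alpha}}_{\mathcal{S}_2})$ for candidates $\mathcal{S}_1,\mathcal{S}_2$, then $Q_{\boldsymbol{x}}(\mathcal{S}_1)\le Q_{\boldsymbol{x}}(\mathcal{S}_2)$ for every $\boldsymbol{x}\in\mathbb{R}^d$.
   Context: Let $\mathcal{H}$ be a real Hilbert space (a reproducing kernel Hilbert space), $\boldsymbol{\phi}:\mathbb{R}^d\to\mathcal{H}$ a feature map, and $k(\boldsymbol{x},\boldsymbol{x}')=\boldsymbol{\phi}(\boldsymbol{x})^\top\boldsymbol{\phi}(\boldsymbol{x}')$ the kernel, where $\boldsymbol{a}^\top\boldsymbol{b}$ denotes the inner product of $\mathcal{H}$ and $\|\cdot\|_2$ its norm. The model with parameter $\boldsymbol{\theta}\in\mathcal{H}$ is $f(\boldsymbol{x};\boldsymbol{\theta})=\boldsymbol{\phi}(\boldsymbol{x})^\top\boldsymbol{\theta}$. The loss $\ell(y,t)$ is a real-valued function of a label $y$ and a real prediction $t$, convex and continuous in $t$. The original dataset is $\mathcal{O}=\{(\boldsymbol{x}_i^{\mathcal{O}},y_i^{\mathcal{O}})\}_{i=1}^{n_{\mathcal{O}}}$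 with $\boldsymbol{x}_i^{\mathcal{O}}\in\mathbb{R}^d$, $y_i^{\mathcal{O}}\in\{-1,+1\}$; a synthetic dataset is $\mathcal{S}=\{(\boldsymbol{x}_i^{\mathcal{S}},y_i^{\mathcal{S}})\}_{i=1}^{n_{\mathcal{S}}}$ with $\boldsymbol{x}_i^{\mathcal{S}}\in\mathbb{R}^d$, $y_i^{\mathcal{S}}\in\mathbb{R}$. For a dataset $\mathcal{D}$ (either $\mathcal{O}$ or a synthetic $\mathcal{S}$) the primal objective is $$P_{\mathcal{D}}(\boldsymbol{\theta})=\sum_{i=1}^{n_{\mathcal{D}}}\ell(y_i^{\mathcal{D}},f(\boldsymbol{x}_i^{\mathcal{D}};\boldsymbol{\theta}))+\frac{\lambda}{2}\|\boldsymbol{\theta}\|_2^2 .$$ The dual objective for $\mathcal{S}$ is, for $\boldsymbol{\alpha}\in\mathbb{R}^{n_{\mathcal{S}}}$, $$D_{\mathcal{S}}(\boldsymbol{\alpha})=-\sum_{i=1}^{n_{\mathcal{S}}}\ell^*(y_i^{\mathcal{S}},-y_i^{\mathcal{S}}\alpha_i)-\frac{1}{2\lambda}\sum_{i=1}^{n_{\mathcal{S}}}\sum_{j=1}^{n_{\mathcal{S}}}\alpha_i\alpha_j\,y_i^{\mathcal{S}}y_j^{\mathcal{S}}\,k(\boldsymbol{x}_i^{\mathcal{S}},\boldsymbol{x}_j^{\mathcal{S}}),$$ where $\ell^*(y,s)=\sup_{t\in\mathbb{R}}\{st-\ell(y,t)\}$ is the convex conjugate in the second argument, and $\mathrm{dom}(D_{\mathcal{S}})=\{\boldsymbol{\alpha}:D_{\mathcal{S}}(\boldsymbol{\alpha})>-\infty\}$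 is the set of feasible dual variables. The set of candidate synthetic datasets is arbitrary; $\lambda$, $\ell$, $\boldsymbol{\phi}$ are the same for all candidates. A convex function $F$ with nonempty domain is $\lambda$-strongly convex if for all $\boldsymbol{\theta},\boldsymbol{\theta}'\in\mathrm{dom}(F)$ and every subgradient $\boldsymbol{g}\in\partial F(\boldsymbol{\theta}')$ one has $F(\boldsymbol{\theta})-F(\boldsymbol{\theta}')\ge\boldsymbol{g}^\top(\boldsymbol{\theta}-\boldsymbol{\theta}')+\frac{\lambda}{2}\|\boldsymbol{\theta}-\boldsymbol{\theta}'\|_2^2$. *)

theory Defs
  imports "HOL-Analysis.Analysis"
begin

text \<open>A dataset of \<open>n\<close> labelled points in \<open>\<real>\<^sup>d\<close> is the list of its pairs \<open>(x\<^sub>i, y\<^sub>i)\<close>; its indices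
  run over \<open>0, \<dots>, n - 1\<close>. The dual variables in \<open>\<real>\<^sup>n\<close> are the real lists of length \<open>n\<close>.\<close>

type_synonym 'd dataset = "((real ^ 'd) \<times> real) list"

abbreviation pt :: "'d dataset \<Rightarrow> nat \<Rightarrow> real ^ 'd" where
  "pt D i \<equiv> fst (D ! i)"

abbreviation lab :: "'d dataset \<Rightarrow> nat \<Rightarrow> real" where
  "lab D i \<equiv> snd (D ! i)"

definition kernel :: "(real ^ 'd \<Rightarrow> 'h::real_inner) \<Rightarrow> real ^ 'd \<Rightarrow> real ^ 'd \<Rightarrow> real" where
  "kernel \<phi> x x' = \<phi> x \<bullet> \<phi> x'"

definition model :: "(real ^ 'd \<Rightarrow> 'h::real_inner) \<Rightarrow> real ^ 'd \<Rightarrow> 'h \<Rightarrow> real" where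
  "model \<phi> x \<theta> = \<phi> x \<bullet> \<theta>"

definition primal ::
    "(real \<Rightarrow> real \<Rightarrow> real) \<Rightarrow> (real ^ 'd \<Rightarrow> 'h::real_inner) \<Rightarrow> real \<Rightarrow> 'd dataset \<Rightarrow> 'h \<Rightarrow> real" where
  "primal loss \<phi> lam D \<theta> =
     (\<Sum>i<length D. loss (lab D i) (model \<phi> (pt D i) \<theta>)) + lam / 2 * (norm \<theta>)\<^sup>2"

definition loss_conjugate :: "(real \<Rightarrow> real \<Rightarrow> real) \<Rightarrow> real \<Rightarrow> real \<Rightarrow> ereal" where
  "loss_conjugate loss y s = (SUP t::real. ereal (s * t - loss y t))"

text \<open>Since \<open>loss\<close> is real-valued, its conjugate is never \<open>-\<infinity>\<close>, so the extended sum below never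
  adds \<open>\<infinity>\<close> and \<open>-\<infinity>\<close>.\<close>

definition dual ::
    "(real \<Rightarrow> real \<Rightarrow> real) \<Rightarrow> (real ^ 'd \<Rightarrow> 'h::real_inner) \<Rightarrow> real \<Rightarrow> 'd dataset \<Rightarrow> real list \<Rightarrow> ereal" where
  "dual loss \<phi> lam S \<alpha> =
     - (\<Sum>i<length S. loss_conjugate loss (lab S i) (- lab S i * \<alpha> ! i))
     - ereal (1 / (2 * lam) * (\<Sum>i<length S. \<Sum>j<length S.
         \<alpha> ! i * \<alpha> ! j * lab S i * lab S j * kernel \<phi> (pt S i) (pt S j)))"

definition dual_dom ::
    "(real \<Rightarrow> real \<Rightarrow> real) \<Rightarrow> (real ^ 'd \<Rightarrow> 'h::real_inner) \<Rightarrow> real \<Rightarrow> 'd dataset \<Rightarrow> real list set" where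
  "dual_dom loss \<phi> lam S = {\<alpha>. length \<alpha> = length S \<and> dual loss \<phi> lam S \<alpha> > -\<infinity>}"

definition duality_gap ::
    "(real \<Rightarrow> real \<Rightarrow> real) \<Rightarrow> (real ^ 'd \<Rightarrow> 'h::real_inner) \<Rightarrow> real \<Rightarrow> 'd dataset \<Rightarrow> 'h \<Rightarrow> real list \<Rightarrow> ereal" where
  "duality_gap loss \<phi> lam S \<theta> \<alpha> = ereal (primal loss \<phi> lam S \<theta>) - dual loss \<phi> lam S \<alpha>"

text \<open>The gap is finite for \<open>\<alpha> \<in> dual_dom loss \<phi> lam S\<close>, the only case in which the ball is used, so
  there \<open>real_of_ereal\<close> loses nothing.\<close>

definition gap_ball ::
    "(real \<Rightarrow> real \<Rightarrow> real) \<Rightarrow> (real ^ 'd \<Rightarrow> 'h::real_inner) \<Rightarrow> real \<Rightarrow> 'h \<Rightarrow> 'd dataset \<Rightarrow> real list \<Rightarrow> 'h set" where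
  "gap_ball loss \<phi> lam \<theta>\<^sub>0 S \<alpha> =
     {\<theta>. norm (\<theta> - \<theta>\<^sub>0) \<le> sqrt (2 / lam * real_of_ereal (duality_gap loss \<phi> lam S \<theta>\<^sub>0 \<alpha>))}"

definition worst_case_diff ::
    "(real \<Rightarrow> real \<Rightarrow> real) \<Rightarrow> (real ^ 'd \<Rightarrow> 'h::real_inner) \<Rightarrow> real \<Rightarrow> 'h \<Rightarrow> real ^ 'd
      \<Rightarrow> 'd dataset \<Rightarrow> real list \<Rightarrow> real" where
  "worst_case_diff loss \<phi> lam \<theta>\<^sub>0 x S \<alpha> =
     (GREATEST q. q \<in> (\<lambda>\<theta>. \<bar>\<phi> x \<bullet> \<theta> - \<phi> x \<bullet> \<theta>\<^sub>0\<bar>) ` gap_ball loss \<phi> lam \<theta>\<^sub>0 S \<alpha>)"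

text \<open>An extended-valued convex function is given by its effective domain \<open>A\<close> together with its
  real values on \<open>A\<close>.\<close>

definition subdifferential_on :: "'h::real_inner set \<Rightarrow> ('h \<Rightarrow> real) \<Rightarrow> 'h \<Rightarrow> 'h set" where
  "subdifferential_on A F \<theta>' = {g. \<forall>\<theta>\<in>A. F \<theta> \<ge> F \<theta>' + g \<bullet> (\<theta> - \<theta>')}"

definition strongly_convex_on :: "'h::real_inner set \<Rightarrow> real \<Rightarrow> ('h \<Rightarrow> real) \<Rightarrow> bool" where
  "strongly_convex_on A lam F \<longleftrightarrow>
     A \<noteq> {} \<and> convex_on A F \<and>
     (\<forall>\<theta>\<in>A. \<forall>\<theta>'\<in>A. \<forall>g\<in>subdifferential_on A F \<theta>'.
        F \<theta> - F \<theta>' \<ge> g \<bullet> (\<theta> - \<theta>') + lam / 2 * (norm (\<theta> - \<theta>'))\<^sup>2)"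

end

theory Submission
  imports Defs
begin

text \<open>Weak duality, i.e. the Fenchel--Young inequality for the loss terms and for the quadratic
  regulariser, makes every duality gap a nonnegative real number. Hence the ball around
  \<open>\<theta>\<^sub>O\<close> is nonempty, and by the equality case of Cauchy--Schwarz the worst-case difference at \<open>x\<close> is
  \<open>norm (\<phi> x)\<close> times the radius, a nondecreasing function of the gap.\<close>

text \<open>Fenchel--Young for the loss terms, at slope \<open>- lab S i * a ! i\<close> and
  prediction \<open>t i\<close>, sums to the cross term \<open>- (w \<bullet> \<theta>)\<close>; the
  inequality for the regulariser contributes \<open>w \<bullet> \<theta>\<close>, and the two
  cancel.\<close>

lemma dual_le_primal:
  fixes \<phi> :: "real ^ 'd \<Rightarrow> 'h::real_inner"
  assumes "lam > 0"
  shows "dual loss \<phi> lam S a \<le> ereal (primal loss \<phi> lam S \<theta>)"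
proof -
  define n where "n = length S"
  define t where "t i = model \<phi> (pt S i) \<theta>" for i
  \<comment> \<open>Up to the factor \<open>1 / lam\<close>, this is the primal point attached to
    the dual variable \<open>a\<close>. The kernel double sum in the dual is the squared norm of
    \<open>w\<close>.\<close>
  define w where "w = (\<Sum>i<n. (a ! i * lab S i) *\<^sub>R \<phi> (pt S i))"
  have inner_w: "w \<bullet> \<theta> = (\<Sum>i<n. a ! i * lab S i * t i)"
    by (simp add: w_def t_def model_def inner_sum_left)
  have norm_w: "(norm w)\<^sup>2 = (\<Sum>i<n. \<Sum>j<n. a ! i * a ! j * lab S i * lab S j * kernel \<phi> (pt S i) (pt S j))"
    unfolding power2_norm_eq_inner w_def inner_sum_left inner_sum_right kernel_def
    by (intro sum.cong refl) (simp add: inner_commute)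
  \<comment> \<open>Completing the square: this is the slack in Fenchel--Young for the regulariser,
    and it vanishes exactly when \<open>lam *\<^sub>R \<theta> = w\<close>.\<close>
  have "0 \<le> (norm (lam *\<^sub>R \<theta> - w))\<^sup>2 / (2 * lam)"
    using assms by simp
  also have "\<dots> = lam / 2 * (norm \<theta>)\<^sup>2 - w \<bullet> \<theta> + 1 / (2 * lam) * (norm w)\<^sup>2"
    using assms unfolding power2_norm_eq_inner
    by (simp add: inner_diff_left inner_diff_right inner_commute[of \<theta> w] field_simps)
  finally have young: "w \<bullet> \<theta> - 1 / (2 * lam) * (norm w)\<^sup>2 \<le> lam / 2 * (norm \<theta>)\<^sup>2"
    by simp
  \<comment> \<open>Each \<open>t i\<close> is one competitor in the supremum that defines the
    conjugate.\<close>
  have "ereal (\<Sum>i<n. - lab S i * a ! i * t i - loss (lab S i) (t i))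
        \<le> (\<Sum>i<n. loss_conjugate loss (lab S i) (- lab S i * a ! i))"
    unfolding sum_ereal[symmetric] loss_conjugate_def
    by (intro sum_mono SUP_upper UNIV_I)
  \<comment> \<open>Negation reverses the order on all of \<open>ereal\<close>, so an infinite
    conjugate needs no case of its own.\<close>
  then have "- (\<Sum>i<n. loss_conjugate loss (lab S i) (- lab S i * a ! i))
        \<le> ereal (- (\<Sum>i<n. - lab S i * a ! i * t i - loss (lab S i) (t i)))"
    unfolding uminus_ereal.simps(1)[symmetric] ereal_minus_le_minus .
  also have "- (\<Sum>i<n. - lab S i * a ! i * t i - loss (lab S i) (t i))
        = w \<bullet> \<theta> + (\<Sum>i<n. loss (lab S i) (t i))"
    by (simp add: inner_w sum_subtractf sum_negf mult_ac)
  finally have "dual loss \<phi> lam S a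
      \<le> ereal (w \<bullet> \<theta> + (\<Sum>i<n. loss (lab S i) (t i))) - ereal (1 / (2 * lam) * (norm w)\<^sup>2)"
    unfolding dual_def norm_w n_def by (rule ereal_minus_mono) simp
  also have "\<dots> \<le> ereal (primal loss \<phi> lam S \<theta>)"
    using young by (simp add: primal_def t_def n_def)
  finally show ?thesis .
qed

text \<open>Feasibility keeps the dual value away from -\<infinity>, and weak duality bounds it
  above by a real number, which also fixes the sign.\<close>

lemma duality_gap_finite_nonneg:
  fixes \<phi> :: "real ^ 'd \<Rightarrow> 'h::real_inner"
  assumes "lam > 0" and "a \<in> dual_dom loss \<phi> lam S"
  shows "\<exists>g\<ge>0. duality_gap loss \<phi> lam S \<theta> a = ereal g"
proof -
  have "dual loss \<phi> lam S a > -\<infinity>"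
    using assms(2) by (simp add: dual_dom_def)
  with dual_le_primal[OF assms(1), of loss \<phi> S a \<theta>]
  obtain d where "dual loss \<phi> lam S a = ereal d" "d \<le> primal loss \<phi> lam S \<theta>"
    by (cases "dual loss \<phi> lam S a") auto
  then show ?thesis
    by (simp add: duality_gap_def)
qed

lemma abs_inner_diff_le_radius:
  fixes v :: "'h::real_inner"
  assumes "norm (\<theta> - \<theta>\<^sub>0) \<le> r"
  shows "\<bar>v \<bullet> \<theta> - v \<bullet> \<theta>\<^sub>0\<bar> \<le> r * norm v"
proof -
  have "\<bar>v \<bullet> (\<theta> - \<theta>\<^sub>0)\<bar> \<le> norm v * norm (\<theta> - \<theta>\<^sub>0)"
    by (rule Cauchy_Schwarz_ineq2)
  also have "\<dots> \<le> r * norm v"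
    using assms by (subst mult.commute) (rule mult_right_mono, simp_all)
  finally show ?thesis
    by (simp add: inner_diff_right)
qed

text \<open>Cauchy--Schwarz is an equality for parallel vectors, so it suffices to move from
  \<open>\<theta>\<^sub>0\<close> a distance \<open>r\<close> in the direction of
  \<open>v\<close>.\<close>

lemma abs_inner_diff_eq_radius:
  fixes v \<theta>\<^sub>0 :: "'h::real_inner"
  assumes "r \<ge> 0"
  shows "\<exists>\<theta>. norm (\<theta> - \<theta>\<^sub>0) \<le> r \<and> \<bar>v \<bullet> \<theta> - v \<bullet> \<theta>\<^sub>0\<bar> = r * norm v"
proof (intro exI conjI)
  \<comment> \<open>For \<open>v = 0\<close> the quotient is \<open>0\<close>.\<close>
  let ?\<theta> = "\<theta>\<^sub>0 + (r / norm v) *\<^sub>R v"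
  show "norm (?\<theta> - \<theta>\<^sub>0) \<le> r"
    using assms by simp
  show "\<bar>v \<bullet> ?\<theta> - v \<bullet> \<theta>\<^sub>0\<bar> = r * norm v"
    using assms by (simp add: inner_add_right dot_square_norm power2_eq_square)
qed

text \<open>An explicit maximizer replaces a compactness argument, which would fail for closed balls
  in infinite dimension.\<close>

lemma gap_ball_attains:
  fixes \<phi> :: "real ^ 'd \<Rightarrow> 'h::real_inner" and \<theta>\<^sub>0 :: 'h
  assumes "lam > 0" and "a \<in> dual_dom loss \<phi> lam S"
  shows "\<exists>\<theta>\<in>gap_ball loss \<phi> lam \<theta>\<^sub>0 S a. \<bar>\<phi> x \<bullet> \<theta> - \<phi> x \<bullet> \<theta>\<^sub>0\<bar>
    = sqrt (2 / lam * real_of_ereal (duality_gap loss \<phi> lam S \<theta>\<^sub>0 a)) * norm (\<phi> x)"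
proof -
  obtain g where "g \<ge> 0" and g: "duality_gap loss \<phi> lam S \<theta>\<^sub>0 a = ereal g"
    using duality_gap_finite_nonneg[OF assms] by blast
  then have "sqrt (2 / lam * g) \<ge> 0"
    using assms(1) by simp
  from abs_inner_diff_eq_radius[OF this, of \<theta>\<^sub>0 "\<phi> x"] show ?thesis
    by (auto simp: gap_ball_def g)
qed

lemma gap_ball_bound:
  assumes "\<theta> \<in> gap_ball loss \<phi> lam \<theta>\<^sub>0 S a"
  shows "\<bar>\<phi> x \<bullet> \<theta> - \<phi> x \<bullet> \<theta>\<^sub>0\<bar>
    \<le> sqrt (2 / lam * real_of_ereal (duality_gap loss \<phi> lam S \<theta>\<^sub>0 a)) * norm (\<phi> x)"
  using assms by (intro abs_inner_diff_le_radius) (simp add: gap_ball_def)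

text \<open>\<open>GREATEST\<close> is determined only once a greatest element is exhibited:
  attainment gives membership and Cauchy--Schwarz the upper bound. In the resulting closed form the
  dataset enters only through its gap.\<close>

lemma worst_case_diff_eq:
  fixes \<phi> :: "real ^ 'd \<Rightarrow> 'h::real_inner"
  assumes "lam > 0" and "a \<in> dual_dom loss \<phi> lam S"
  shows "worst_case_diff loss \<phi> lam \<theta>\<^sub>0 x S a
    = sqrt (2 / lam * real_of_ereal (duality_gap loss \<phi> lam S \<theta>\<^sub>0 a)) * norm (\<phi> x)"
  unfolding worst_case_diff_def
proof (rule Greatest_equality)
  show "sqrt (2 / lam * real_of_ereal (duality_gap loss \<phi> lam S \<theta>\<^sub>0 a)) * norm (\<phi> x)
      \<in> (\<lambda>\<theta>. \<bar>\<phi> x \<bullet> \<theta> - \<phi> x \<bullet> \<theta>\<^sub>0\<bar>) ` gap_ball loss \<phi> lam \<theta>\<^sub>0 S a"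
    using gap_ball_attains[OF assms, of \<theta>\<^sub>0 x] by (metis imageI)
qed (elim imageE, simp only: gap_ball_bound)

lemma worst_case_diff_mono:
  fixes \<phi> :: "real ^ 'd \<Rightarrow> 'h::real_inner"
  assumes "lam > 0" and "a \<in> dual_dom loss \<phi> lam S" and "b \<in> dual_dom loss \<phi> lam T"
    and "duality_gap loss \<phi> lam S \<theta>\<^sub>0 a \<le> duality_gap loss \<phi> lam T \<theta>\<^sub>0 b"
  shows "worst_case_diff loss \<phi> lam \<theta>\<^sub>0 x S a \<le> worst_case_diff loss \<phi> lam \<theta>\<^sub>0 x T b"
proof -
  \<comment> \<open>\<open>real_of_ereal\<close> sends both infinities to 0 and is not monotone on
    \<open>ereal\<close>, so the gaps are first replaced by real numbers.\<close>
  obtain g h where "duality_gap loss \<phi> lam S \<theta>\<^sub>0 a = ereal g" "duality_gap loss \<phi> lam T \<theta>\<^sub>0 b = ereal h"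
    using duality_gap_finite_nonneg assms(1-3) by meson
  then show ?thesis
    using assms by (simp add: worst_case_diff_eq mult_right_mono divide_right_mono)
qed

theorem lemma3p3:
  fixes \<phi> :: "real ^ 'd \<Rightarrow> 'h :: {real_inner, complete_space}"
    and loss :: "real \<Rightarrow> real \<Rightarrow> real"
    and lam :: real
    and Orig :: "'d dataset"
    and \<theta>\<^sub>O :: 'h
    and Cand :: "'d dataset set"
    and \<alpha> :: "'d dataset \<Rightarrow> real list"
  assumes "\<And>y. convex_on UNIV (loss y)"
    and "\<And>y. continuous_on UNIV (loss y)"
    and "lam > 0"
    and "\<forall>i<length Orig. lab Orig i \<in> {-1, 1}"
    and "strongly_convex_on UNIV lam (primal loss \<phi> lam Orig)"
    and "is_arg_min (primal loss \<phi> lam Orig) (\<lambda>_. True) \<theta>\<^sub>O"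
    and "\<And>\<theta>. is_arg_min (primal loss \<phi> lam Orig) (\<lambda>_. True) \<theta> \<Longrightarrow> \<theta> = \<theta>\<^sub>O"
    and "\<And>S. S \<in> Cand \<Longrightarrow> \<alpha> S \<in> dual_dom loss \<phi> lam S"
  defines "G \<equiv> \<lambda>S. duality_gap loss \<phi> lam S \<theta>\<^sub>O (\<alpha> S)"
    and "Q \<equiv> \<lambda>x S. worst_case_diff loss \<phi> lam \<theta>\<^sub>O x S (\<alpha> S)"
  shows "(\<forall>S\<in>Cand. \<forall>x. \<exists>\<theta>\<in>gap_ball loss \<phi> lam \<theta>\<^sub>O S (\<alpha> S). \<forall>\<theta>'\<in>gap_ball loss \<phi> lam \<theta>\<^sub>O S (\<alpha> S).
            \<bar>\<phi> x \<bullet> \<theta>' - \<phi> x \<bullet> \<theta>\<^sub>O\<bar> \<le> \<bar>\<phi> x \<bullet> \<theta> - \<phi> x \<bullet> \<theta>\<^sub>O\<bar>) \<and>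
         (\<forall>S\<^sub>0. is_arg_min G (\<lambda>S. S \<in> Cand) S\<^sub>0 \<longrightarrow>
            (\<forall>x. is_arg_min (Q x) (\<lambda>S. S \<in> Cand) S\<^sub>0)) \<and>
         (\<forall>S\<^sub>1\<in>Cand. \<forall>S\<^sub>2\<in>Cand. G S\<^sub>1 \<le> G S\<^sub>2 \<longrightarrow> (\<forall>x. Q x S\<^sub>1 \<le> Q x S\<^sub>2))"
proof (intro conjI)
  note feasible = assms(8)
  \<comment> \<open>This certifies that the maximum behind \<open>Q\<close> exists, so that
    \<open>GREATEST\<close> denotes it.\<close>
  show "\<forall>S\<in>Cand. \<forall>x. \<exists>\<theta>\<in>gap_ball loss \<phi> lam \<theta>\<^sub>O S (\<alpha> S). \<forall>\<theta>'\<in>gap_ball loss \<phi> lam \<theta>\<^sub>O S (\<alpha> S).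
      \<bar>\<phi> x \<bullet> \<theta>' - \<phi> x \<bullet> \<theta>\<^sub>O\<bar> \<le> \<bar>\<phi> x \<bullet> \<theta> - \<phi> x \<bullet> \<theta>\<^sub>O\<bar>"
  proof (intro ballI allI)
    fix S x
    assume "S \<in> Cand"
    from gap_ball_attains[OF \<open>lam > 0\<close> feasible[OF this], of \<theta>\<^sub>O x]
    show "\<exists>\<theta>\<in>gap_ball loss \<phi> lam \<theta>\<^sub>O S (\<alpha> S). \<forall>\<theta>'\<in>gap_ball loss \<phi> lam \<theta>\<^sub>O S (\<alpha> S).
        \<bar>\<phi> x \<bullet> \<theta>' - \<phi> x \<bullet> \<theta>\<^sub>O\<bar> \<le> \<bar>\<phi> x \<bullet> \<theta> - \<phi> x \<bullet> \<theta>\<^sub>O\<bar>"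
      by (elim bexE, intro bexI ballI) (simp_all only: gap_ball_bound)
  qed
  have mono: "Q x S \<le> Q x T" if "S \<in> Cand" "T \<in> Cand" "G S \<le> G T" for x S T
    using that worst_case_diff_mono[OF \<open>lam > 0\<close> feasible feasible] by (simp add: G_def Q_def)
  then show "\<forall>S\<^sub>1\<in>Cand. \<forall>S\<^sub>2\<in>Cand. G S\<^sub>1 \<le> G S\<^sub>2 \<longrightarrow> (\<forall>x. Q x S\<^sub>1 \<le> Q x S\<^sub>2)"
    by blast
  show "\<forall>S\<^sub>0. is_arg_min G (\<lambda>S. S \<in> Cand) S\<^sub>0 \<longrightarrow> (\<forall>x. is_arg_min (Q x) (\<lambda>S. S \<in> Cand) S\<^sub>0)"
    \<comment> \<open>Both \<open>ereal\<close> and \<open>real\<close> are linearly ordered, so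
      being an \<open>is_arg_min\<close> means lying below every candidate value, and
      \<open>mono\<close> carries this from \<open>G\<close> to \<open>Q x\<close>.\<close>
    using mono by (simp add: is_arg_min_linorder)
qed

end
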